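(* Let $\kappa$ be a field and let $\kappa[\![\mathbf{u}^{S'}]\!]/\kappa[\![\mathbf{u}^{S}]\!]$ be a numerical semigroup algebra, where $S\subset S'$ are numerical semigroups which are subsets of $\mathbb{N}$, with greatest common divisors $d'$ (of $S'$) and $d$ (of $S$). There are at least $d/d'$ Apéry monomials of this algebra. The following conditions are equivalent: (1) The algebra $\kappa[\![\mathbf{u}^{S'}]\!]/\kappa[\![\mathbf{u}^{S}]\!]$ is flat. (2) The algebra $\kappa[\![\mathbf{u}^{S'}]\!]/\kappa[\![\mathbf{u}^{S}]\!]$ has $d/d'$ Apéry monomials. (3) $\Delta_S(S')\cap (d/d')\mathbb{Z}\subset S$. In particular, if the algebra is flat, then $S=S'\cap (d/d')\mathbb{Z}$.
   Context: A numerical semigroup is a monoid $S$ (under addition) generated by finitely many positive rational numbers. The numerical semigroup ring $\kappa[\![\mathbf{u}^S]\!]$ consists of all power series $\sum_{s\in S}a_s\mathbf{u}^s$ with $a_s\in\kappa$; the elements $\mathbf{u}^s$ ($s\in S$) are its monomials. For numerical semigroups $S\subset S'$, the ring $R'=\kappa[\![\mathbf{u}^{S'}]\!]$ is an algebra over $R=\kappa[\![\mathbf{u}^{S}]\!]$ via inclusion, denoted $R'/R$ and called a numerical semigroup algebra; it is flat if $R'$ is a flat $R$-module. A monomial $p$ of $R'$ is an Apéry monomial of $R'/R$ if, whenever $p=p_1p_2$ with $p_1$ a monomial of $R$ and $p_2$ a monomial of $R'$, then $p_1=1$. $\Delta_S(S')$ denotes the set of all differences $a_1-a_2$ with $a_1\ge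 a_2$ such that $\mathbf{u}^{a_1}$ and $\mathbf{u}^{a_2}$ are Apéry monomials of $\kappa[\![\mathbf{u}^{S'}]\!]/\kappa[\![\mathbf{u}^{S}]\!]$. $\mathbb{N}$ denotes the set of non-negative integers.
   Formalization: In (3) and the final claim, (d/d')ℤ is corrected to dℤ: for S=4ℕ, S'=2ℕ the algebra is flat with d/d'=2 Apéry monomials, but Δ∩2ℤ={0,2} is not in S and S'∩2ℤ≠S. The two versions agree when d' and d/d' are coprime. The degenerate semigroup {0} is excluded. *)

theory Defs
  imports
    "HOL-Algebra.Module"
    "HOL-Algebra.Free_Abelian_Groups"
    "HOL-Computational_Algebra.Formal_Power_Series"
begin

section \<open>Tensor products and flat modules\<close>

definition module_maps ::
  "('r, 'a) ring_scheme \<Rightarrow> ('r, 'm, 'b) module_scheme \<Rightarrow> ('r, 'n, 'c) module_scheme \<Rightarrow> ('m \<Rightarrow> 'n) set"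
  where "module_maps R M N =
    {f. f \<in> carrier M \<rightarrow> carrier N \<and>
        (\<forall>x\<in>carrier M. \<forall>y\<in>carrier M. f (x \<oplus>\<^bsub>M\<^esub> y) = f x \<oplus>\<^bsub>N\<^esub> f y) \<and>
        (\<forall>r\<in>carrier R. \<forall>x\<in>carrier M. f (r \<odot>\<^bsub>M\<^esub> x) = r \<odot>\<^bsub>N\<^esub> f x)}"

definition tensor_relations ::
  "('r, 'a) ring_scheme \<Rightarrow> ('r, 'm, 'b) module_scheme \<Rightarrow> ('r, 'n, 'c) module_scheme \<Rightarrow>
    ('m \<times> 'n \<Rightarrow>\<^sub>0 int) set"
  where "tensor_relations R M P =
    generate (free_Abelian_group (carrier M \<times> carrier P))
     ({frag_of (x \<oplus>\<^bsub>M\<^esub> x', y) - frag_of (x, y) - frag_of (x', y) | x x' y.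
          x \<in> carrier M \<and> x' \<in> carrier M \<and> y \<in> carrier P}
    \<union> {frag_of (x, y \<oplus>\<^bsub>P\<^esub> y') - frag_of (x, y) - frag_of (x, y') | x y y'.
          x \<in> carrier M \<and> y \<in> carrier P \<and> y' \<in> carrier P}
    \<union> {frag_of (r \<odot>\<^bsub>M\<^esub> x, y) - frag_of (x, r \<odot>\<^bsub>P\<^esub> y) | r x y.
          r \<in> carrier R \<and> x \<in> carrier M \<and> y \<in> carrier P})"

text \<open>The underlying (multiplicatively written) abelian group of the tensor product of \<open>M\<close>
  and \<open>P\<close> over the commutative ring \<open>R\<close>.\<close>

definition tensor_product ::
  "('r, 'a) ring_scheme \<Rightarrow> ('r, 'm, 'b) module_scheme \<Rightarrow> ('r, 'n, 'c) module_scheme \<Rightarrow>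
    ('m \<times> 'n \<Rightarrow>\<^sub>0 int) set monoid"
  where "tensor_product R M P =
    free_Abelian_group (carrier M \<times> carrier P) Mod tensor_relations R M P"

text \<open>The map from the tensor product of \<open>M\<close> and \<open>P\<close> to that of \<open>N\<close> and \<open>P\<close> induced by
  \<open>f\<close>: the class of a formal sum of pairs \<open>(x, y)\<close> goes to the class of the corresponding sum
  of the \<open>(f x, y)\<close>, which does not depend on the representative when \<open>f\<close> is linear.\<close>

definition tensor_map ::
  "('r, 'a) ring_scheme \<Rightarrow> ('m \<Rightarrow> 'n) \<Rightarrow> ('r, 'n, 'b) module_scheme \<Rightarrow> ('r, 'p, 'c) module_scheme \<Rightarrow>
    ('m \<times> 'p \<Rightarrow>\<^sub>0 int) set \<Rightarrow> ('n \<times> 'p \<Rightarrow>\<^sub>0 int) set"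
  where "tensor_map R f N P = (\<lambda>C. the_elem
    ((\<lambda>c. tensor_relations R N P #>\<^bsub>free_Abelian_group (carrier N \<times> carrier P)\<^esub>
            frag_extend (\<lambda>(x, y). frag_of (f x, y)) c) ` C))"

text \<open>\<open>P\<close> is flat if tensoring with \<open>P\<close> preserves injectivity of linear maps. A definition in
  HOL cannot quantify over modules of all types, so the test modules have their elements in the
  type \<open>'m\<close>, which is a parameter. It has to be large enough: for \<open>'m = unit\<close> every module would
  be flat, whereas as soon as the elements of \<open>R\<close> embed into \<open>'m\<close>, all ideals of \<open>R\<close> occur among
  the test modules up to isomorphism.\<close>

definition flat_module ::
  "'m itself \<Rightarrow> ('r, 'a) ring_scheme \<Rightarrow> ('r, 'p, 'b) module_scheme \<Rightarrow> bool"
  where "flat_module _ R P \<longleftrightarrow> Module.module R P \<and>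
    (\<forall>(M :: ('r, 'm) module) (N :: ('r, 'm) module) f.
       Module.module R M \<and> Module.module R N \<and> f \<in> module_maps R M N \<and> inj_on f (carrier M) \<longrightarrow>
       inj_on (tensor_map R f N P) (carrier (tensor_product R M P)))"

section \<open>Numerical semigroups and their algebras\<close>

text \<open>The generating set is required to be nonempty, so that \<open>{0}\<close> is not a numerical
  semigroup.\<close>

definition numerical_semigroup :: "rat set \<Rightarrow> bool"
  where "numerical_semigroup S \<longleftrightarrow>
    (\<exists>G. finite G \<and> G \<noteq> {} \<and> (\<forall>g\<in>G. 0 < g) \<and>
         S = (\<lambda>T. 0 \<in> T \<and> (\<forall>x\<in>T. \<forall>y\<in>T. x + y \<in> T)) hull G)"

text \<open>For sets \<open>S\<close> of natural numbers, the power series with exponents in \<open>S\<close> are ordinary formal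
  power series; the monomial with exponent \<open>s\<close> is \<open>fps_X ^ s\<close>.\<close>

definition fps_supported_on :: "nat set \<Rightarrow> 'k::zero fps set"
  where "fps_supported_on S = {f. \<forall>n. fps_nth f n \<noteq> 0 \<longrightarrow> n \<in> S}"

definition semigroup_ring :: "nat set \<Rightarrow> 'k::field fps ring"
  where "semigroup_ring S =
    \<lparr>carrier = fps_supported_on S, monoid.mult = (*), one = 1, ring.zero = 0, add = (+)\<rparr>"

text \<open>The ring of \<open>S'\<close> with the scalar multiplication given by inclusion of the ring of a smaller
  semigroup.\<close>

definition semigroup_algebra :: "nat set \<Rightarrow> ('k::field fps, 'k fps) module"
  where "semigroup_algebra S' =
    \<lparr>carrier = fps_supported_on S', monoid.mult = (*), one = 1, ring.zero = 0, add = (+),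
     smult = (*)\<rparr>"

definition monomials :: "nat set \<Rightarrow> 'k::field fps set"
  where "monomials S = (\<lambda>s. fps_X ^ s) ` S"

definition apery_monomials :: "nat set \<Rightarrow> nat set \<Rightarrow> 'k::field fps set"
  where "apery_monomials S S' =
    {p \<in> monomials S'. \<forall>p1\<in>monomials S. \<forall>p2\<in>monomials S'. p = p1 * p2 \<longrightarrow> p1 = 1}"

text \<open>The set \<open>\<Delta>\<^sub>S(S')\<close>; the type argument is the coefficient field.\<close>

definition apery_differences :: "'k::field itself \<Rightarrow> nat set \<Rightarrow> nat set \<Rightarrow> nat set"
  where "apery_differences _ S S' =
    {a1 - a2 | a1 a2. a2 \<le> a1 \<and> (fps_X ^ a1 :: 'k fps) \<in> apery_monomials S S' \<and>
                      (fps_X ^ a2 :: 'k fps) \<in> apery_monomials S S'}"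

end

theory Submission
  imports Defs
begin

text \<open>Write \<open>R \<subseteq> R'\<close> for the two rings and \<open>W\<close> for the set of exponents of Apery monomials.
  Reduction modulo \<open>d\<close> maps \<open>W\<close> onto the \<open>d / d'\<close> multiples of \<open>d'\<close> below \<open>d\<close>, because every
  element of \<open>S'\<close> is congruent to an element of \<open>W\<close>. So there are at least \<open>d / d'\<close> Apery monomials,
  with equality iff reduction is injective on \<open>W\<close>; as two distinct elements of \<open>W\<close> never differ by
  an element of \<open>S\<close>, this is also what the condition on differences says. If reduction is injective,
  then \<open>S'\<close> is the disjoint union of the \<open>w + S\<close> with \<open>w \<in> W\<close>, so \<open>R'\<close> is free with basis
  \<open>u\<^sup>w\<close>, hence flat. If it is not, then \<open>s + w = t + v\<close> for some \<open>v < w\<close> in \<open>W\<close> and \<open>s < t\<close> in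
  \<open>S\<close>, and this relation between minimal generators contradicts the injectivity of
  \<open>I \<otimes> R' \<rightarrow> R \<otimes> R'\<close>, where \<open>I\<close> consists of the series in \<open>R\<close> of order at least \<open>s\<close>.\<close>

section \<open>Tensor products\<close>

lemma keys_diff_subset:
  "Poly_Mapping.keys a \<subseteq> A \<Longrightarrow> Poly_Mapping.keys b \<subseteq> A \<Longrightarrow> Poly_Mapping.keys (a - b) \<subseteq> A"
  using keys_diff [of a b] by auto

text \<open>Reduces claims about relations to the three kinds of generators. The module assumptions
  keep the generators inside the carrier of the free group, where the group inverse is unary
  minus.\<close>

lemma tensor_relations_induct [consumes 3, case_names zero minus add left right balanced]:
  assumes M: "Module.module R M" and P: "Module.module R P"
    and c: "c \<in> tensor_relations R M P"
    and zero: "Q 0"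
    and minus: "\<And>a. Q a \<Longrightarrow> Q (- a)"
    and add: "\<And>a b. Q a \<Longrightarrow> Q b \<Longrightarrow> Q (a + b)"
    and left: "\<And>x x' y. x \<in> carrier M \<Longrightarrow> x' \<in> carrier M \<Longrightarrow> y \<in> carrier P \<Longrightarrow>
      Q (frag_of (x \<oplus>\<^bsub>M\<^esub> x', y) - frag_of (x, y) - frag_of (x', y))"
    and right: "\<And>x y y'. x \<in> carrier M \<Longrightarrow> y \<in> carrier P \<Longrightarrow> y' \<in> carrier P \<Longrightarrow>
      Q (frag_of (x, y \<oplus>\<^bsub>P\<^esub> y') - frag_of (x, y) - frag_of (x, y'))"
    and balanced: "\<And>r x y. r \<in> carrier R \<Longrightarrow> x \<in> carrier M \<Longrightarrow> y \<in> carrier P \<Longrightarrow>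
      Q (frag_of (r \<odot>\<^bsub>M\<^esub> x, y) - frag_of (x, r \<odot>\<^bsub>P\<^esub> y))"
  shows "Q c"
proof -
  interpret M: Module.module R M by (rule M)
  interpret P: Module.module R P by (rule P)
  show ?thesis
    using c unfolding tensor_relations_def
  proof (induction rule: generate.induct)
    case one
    then show ?case using zero by simp
  next
    case (incl h)
    then show ?case using left right balanced by auto
  next
    case (inv h)
    then have "Q h" using left right balanced by auto
    moreover have "Poly_Mapping.keys h \<subseteq> carrier M \<times> carrier P"
      using inv by (elim UnE CollectE exE conjE) (simp_all add: keys_diff_subset)
    ultimately show ?case by (simp add: minus)
  next
    case (eng h1 h2)
    then show ?case by (simp add: add)
  qed
qed

lemma tensor_relations_subgroup:
  assumes M: "Module.module R M" and P: "Module.module R P"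
  shows "subgroup (tensor_relations R M P) (free_Abelian_group (carrier M \<times> carrier P))"
proof -
  interpret M: Module.module R M by (rule M)
  interpret P: Module.module R P by (rule P)
  show ?thesis
    unfolding tensor_relations_def
    by (rule group.generate_is_subgroup [OF group_free_Abelian_group])
       (auto simp: keys_diff_subset)
qed

lemma tensor_relations_closed:
  assumes M: "Module.module R M" and P: "Module.module R P"
  shows "0 \<in> tensor_relations R M P"
    and "a \<in> tensor_relations R M P \<Longrightarrow> Poly_Mapping.keys a \<subseteq> carrier M \<times> carrier P"
    and "a \<in> tensor_relations R M P \<Longrightarrow> b \<in> tensor_relations R M P \<Longrightarrow> a + b \<in> tensor_relations R M P"
    and "a \<in> tensor_relations R M P \<Longrightarrow> - a \<in> tensor_relations R M P"
    and "a \<in> tensor_relations R M P \<Longrightarrow> b \<in> tensor_relations R M P \<Longrightarrow> a - b \<in> tensor_relations R M P"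
proof -
  interpret subgroup "tensor_relations R M P" "free_Abelian_group (carrier M \<times> carrier P)"
    by (rule tensor_relations_subgroup [OF assms])
  show "0 \<in> tensor_relations R M P" using one_closed by simp
  show keys: "Poly_Mapping.keys a \<subseteq> carrier M \<times> carrier P" if "a \<in> tensor_relations R M P" for a
    using mem_carrier [OF that] by simp
  show add: "a + b \<in> tensor_relations R M P"
    if "a \<in> tensor_relations R M P" "b \<in> tensor_relations R M P" for a b
    using m_closed [OF that] by simp
  show minus: "- a \<in> tensor_relations R M P" if "a \<in> tensor_relations R M P" for a
    using m_inv_closed [OF that] keys [OF that] by simp
  show "a - b \<in> tensor_relations R M P"
    if "a \<in> tensor_relations R M P" "b \<in> tensor_relations R M P"
    using add [OF that(1) minus [OF that(2)]] by simp
qed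

lemma tensor_relations_gens:
  shows "x \<in> carrier M \<Longrightarrow> x' \<in> carrier M \<Longrightarrow> y \<in> carrier P \<Longrightarrow>
      frag_of (x \<oplus>\<^bsub>M\<^esub> x', y) - frag_of (x, y) - frag_of (x', y) \<in> tensor_relations R M P"
    and "x \<in> carrier M \<Longrightarrow> y \<in> carrier P \<Longrightarrow> y' \<in> carrier P \<Longrightarrow>
      frag_of (x, y \<oplus>\<^bsub>P\<^esub> y') - frag_of (x, y) - frag_of (x, y') \<in> tensor_relations R M P"
    and "r \<in> carrier R \<Longrightarrow> x \<in> carrier M \<Longrightarrow> y \<in> carrier P \<Longrightarrow>
      frag_of (r \<odot>\<^bsub>M\<^esub> x, y) - frag_of (x, r \<odot>\<^bsub>P\<^esub> y) \<in> tensor_relations R M P"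
  unfolding tensor_relations_def by (rule generate.incl; blast)+

lemma r_coset_free_Abelian_group_eq_iff:
  assumes H: "subgroup H (free_Abelian_group A)"
    and a: "Poly_Mapping.keys a \<subseteq> A" and b: "Poly_Mapping.keys b \<subseteq> A"
  shows "H #>\<^bsub>free_Abelian_group A\<^esub> a = H #>\<^bsub>free_Abelian_group A\<^esub> b \<longleftrightarrow> a - b \<in> H"
proof -
  let ?G = "free_Abelian_group A"
  interpret group ?G by simp
  have "H #>\<^bsub>?G\<^esub> a = H #>\<^bsub>?G\<^esub> b \<longleftrightarrow> a \<in> H #>\<^bsub>?G\<^esub> b"
    using repr_independence [OF _ _ H, of a b] rcos_self [OF _ H, of a] a b by auto
  also have "\<dots> \<longleftrightarrow> a - b \<in> H"
    by (force simp: r_coset_def diff_eq_eq)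
  finally show ?thesis .
qed

text \<open>The universal property of the tensor product. The map \<open>h\<close> lives on formal
  sums and vanishes on relations, so that it can be evaluated on representatives instead of
  cosets.\<close>

lemma balanced_map_extends:
  fixes A (structure)
  assumes M: "Module.module R M" and P: "Module.module R P" and A: "comm_group A"
    and closed: "\<And>x y. x \<in> carrier M \<Longrightarrow> y \<in> carrier P \<Longrightarrow> \<phi> x y \<in> carrier A"
    and left: "\<And>x x' y. x \<in> carrier M \<Longrightarrow> x' \<in> carrier M \<Longrightarrow> y \<in> carrier P \<Longrightarrow>
      \<phi> (x \<oplus>\<^bsub>M\<^esub> x') y = \<phi> x y \<otimes> \<phi> x' y"
    and right: "\<And>x y y'. x \<in> carrier M \<Longrightarrow> y \<in> carrier P \<Longrightarrow> y' \<in> carrier P \<Longrightarrow>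
      \<phi> x (y \<oplus>\<^bsub>P\<^esub> y') = \<phi> x y \<otimes> \<phi> x y'"
    and balanced: "\<And>r x y. r \<in> carrier R \<Longrightarrow> x \<in> carrier M \<Longrightarrow> y \<in> carrier P \<Longrightarrow>
      \<phi> (r \<odot>\<^bsub>M\<^esub> x) y = \<phi> x (r \<odot>\<^bsub>P\<^esub> y)"
  obtains h where "h \<in> hom (free_Abelian_group (carrier M \<times> carrier P)) A"
    and "\<And>x y. x \<in> carrier M \<Longrightarrow> y \<in> carrier P \<Longrightarrow> h (frag_of (x, y)) = \<phi> x y"
    and "\<And>c. c \<in> tensor_relations R M P \<Longrightarrow> h c = \<one>"
    and "\<And>a b. Poly_Mapping.keys a \<subseteq> carrier M \<times> carrier P \<Longrightarrow>
      Poly_Mapping.keys b \<subseteq> carrier M \<times> carrier P \<Longrightarrow> h (a - b) = h a \<otimes> inv (h b)"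
proof -
  interpret M: Module.module R M by (rule M)
  interpret P: Module.module R P by (rule P)
  interpret A: comm_group A by (rule A)
  let ?D = "carrier M \<times> carrier P"
  let ?G = "free_Abelian_group ?D"
  obtain h where h: "h \<in> hom ?G A" and h_of: "\<And>z. z \<in> ?D \<Longrightarrow> h (frag_of z) = case_prod \<phi> z"
    using A.free_Abelian_group_universal [of "case_prod \<phi>" ?D] closed by (metis (no_types, lifting) SigmaE image_subsetI prod.simps(2))
  interpret h: group_hom ?G A h
    using h by (simp add: group_hom_def group_hom_axioms_def A.is_group)
  have h_in: "h a \<in> carrier A" if "Poly_Mapping.keys a \<subseteq> ?D" for a
    using h.hom_closed [of a] that by simp
  have h_minus: "h (- a) = inv (h a)" if "Poly_Mapping.keys a \<subseteq> ?D" for a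
    using h.hom_inv [of a] that by simp
  have h_add: "h (a + b) = h a \<otimes> h b"
    if "Poly_Mapping.keys a \<subseteq> ?D" "Poly_Mapping.keys b \<subseteq> ?D" for a b
    using h.hom_mult [of a b] that by simp
  have h_diff: "h (a - b) = h a \<otimes> inv (h b)"
    if "Poly_Mapping.keys a \<subseteq> ?D" "Poly_Mapping.keys b \<subseteq> ?D" for a b
    using h_add [of a "- b"] h_minus [of b] that by simp
  have h_diff': "h (frag_of z - frag_of z') = case_prod \<phi> z \<otimes> inv (case_prod \<phi> z')"
    if "z \<in> ?D" "z' \<in> ?D" for z z'
    using that by (simp add: h_diff h_of)
  have h_diff3: "h (frag_of z - frag_of z' - frag_of z'') =
      case_prod \<phi> z \<otimes> inv (case_prod \<phi> z') \<otimes> inv (case_prod \<phi> z'')"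
    if "z \<in> ?D" "z' \<in> ?D" "z'' \<in> ?D" for z z' z''
    using that by (subst h_diff) (auto simp: h_diff' h_of keys_diff_subset)
  \<comment> \<open>The support is carried along in the induction because \<open>h_minus\<close> and
    \<open>h_add\<close> hold only inside the carrier.\<close>
  have "Poly_Mapping.keys c \<subseteq> ?D \<and> h c = \<one>" if "c \<in> tensor_relations R M P" for c
    using M P that
  proof (induction rule: tensor_relations_induct)
    case zero
    then show ?case using h.hom_one by simp
  next
    case (minus a)
    then show ?case by (simp add: h_minus)
  next
    case (add a b)
    then show ?case using keys_add [of a b] by (auto simp: h_add)
  next
    case (left x x' y)
    have "\<phi> x y \<in> carrier A" "\<phi> x' y \<in> carrier A" using left closed by auto
    then have "\<phi> x y \<otimes> \<phi> x' y \<otimes> inv \<phi> x y \<otimes> inv \<phi> x' y = \<one>"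
      by (metis A.inv_solve_right A.inv_closed A.m_closed A.m_comm A.r_inv)
    with left show ?case
      by (auto simp: h_diff3 assms(5) keys_diff_subset)
  next
    case (right x y y')
    have "\<phi> x y \<in> carrier A" "\<phi> x y' \<in> carrier A" using right closed by auto
    then have "\<phi> x y \<otimes> \<phi> x y' \<otimes> inv \<phi> x y \<otimes> inv \<phi> x y' = \<one>"
      by (metis A.inv_solve_right A.inv_closed A.m_closed A.m_comm A.r_inv)
    with right show ?case
      by (auto simp: h_diff3 assms(6) keys_diff_subset)
  next
    case (balanced r x y)
    then show ?case
      by (auto simp: h_diff' assms(7) closed keys_diff_subset)
  qed
  with h h_of h_diff show thesis
    by (intro that [of h]) auto
qed

section \<open>Maps induced on tensor products\<close>

lemma tensor_map_lift:
  assumes M: "Module.module R M" and N: "Module.module R N" and P: "Module.module R P"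
    and f: "f \<in> module_maps R M N"
  shows "Poly_Mapping.keys c \<subseteq> carrier M \<times> carrier P \<Longrightarrow>
      Poly_Mapping.keys (frag_extend (\<lambda>(x, y). frag_of (f x, y)) c) \<subseteq> carrier N \<times> carrier P"
    and "c \<in> tensor_relations R M P \<Longrightarrow>
      frag_extend (\<lambda>(x, y). frag_of (f x, y)) c \<in> tensor_relations R N P"
proof -
  show "Poly_Mapping.keys (frag_extend (\<lambda>(x, y). frag_of (f x, y)) c) \<subseteq> carrier N \<times> carrier P"
    if "Poly_Mapping.keys c \<subseteq> carrier M \<times> carrier P"
    using that f
    by (induction c rule: frag_induction)
       (auto simp: frag_extend_diff module_maps_def Pi_iff keys_diff_subset)
  \<comment> \<open>By linearity of \<open>f\<close>, each kind of generator goes to a generator of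
    the same kind.\<close>
  show "frag_extend (\<lambda>(x, y). frag_of (f x, y)) c \<in> tensor_relations R N P"
    if "c \<in> tensor_relations R M P"
    using M P that
  proof (induction rule: tensor_relations_induct)
    case (left x x' y)
    then show ?case
      using f tensor_relations_gens(1) [of "f x" N "f x'" y P R]
      by (auto simp: frag_extend_diff module_maps_def Pi_iff)
  next
    case (right x y y')
    then show ?case
      using f tensor_relations_gens(2) [of "f x" N y P y' R]
      by (auto simp: frag_extend_diff module_maps_def Pi_iff)
  next
    case (balanced r x y)
    then show ?case
      using f tensor_relations_gens(3) [of r R "f x" N y P]
      by (auto simp: frag_extend_diff module_maps_def Pi_iff)
  qed (simp_all add: frag_extend_minus frag_extend_add tensor_relations_closed [OF N P])
qed

text \<open>Representatives of one coset have congruent images, so the set under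
  \<open>the_elem\<close> in \<open>tensor_map\<close> is a singleton.\<close>

lemma tensor_map_coset:
  assumes M: "Module.module R M" and N: "Module.module R N" and P: "Module.module R P"
    and f: "f \<in> module_maps R M N" and c: "Poly_Mapping.keys c \<subseteq> carrier M \<times> carrier P"
  shows "tensor_map R f N P
      (tensor_relations R M P #>\<^bsub>free_Abelian_group (carrier M \<times> carrier P)\<^esub> c) =
    tensor_relations R N P #>\<^bsub>free_Abelian_group (carrier N \<times> carrier P)\<^esub>
      frag_extend (\<lambda>(x, y). frag_of (f x, y)) c"
proof -
  let ?F = "frag_extend (\<lambda>(x, y). frag_of (f x, y))"
  let ?coset = "\<lambda>b. tensor_relations R N P #>\<^bsub>free_Abelian_group (carrier N \<times> carrier P)\<^esub> b"
  let ?C = "tensor_relations R M P #>\<^bsub>free_Abelian_group (carrier M \<times> carrier P)\<^esub> c"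
  have "?coset (?F b) = ?coset (?F c)" if b: "b \<in> ?C" for b
  proof -
    obtain t where t: "t \<in> tensor_relations R M P" "b = t + c"
      using b by (auto simp: r_coset_def)
    then have b: "Poly_Mapping.keys b \<subseteq> carrier M \<times> carrier P"
      using c tensor_relations_closed(2) [OF M P t(1)] keys_add [of t c] by auto
    have "?F b - ?F c = ?F t" using t by (simp add: frag_extend_add)
    then show ?thesis
      using tensor_map_lift [OF M N P f] b c t(1)
      by (subst r_coset_free_Abelian_group_eq_iff [OF tensor_relations_subgroup [OF N P]]) auto
  qed
  moreover have "c \<in> ?C"
    using tensor_relations_closed(1) [OF M P] by (force simp: r_coset_def)
  ultimately have "(\<lambda>b. ?coset (?F b)) ` ?C = {?coset (?F c)}" by blast
  then show ?thesis by (simp add: tensor_map_def)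
qed

text \<open>The trivial kernel criterion, stated for representatives. Both directions of the
  flatness theorem use injectivity in this form.\<close>

lemma inj_on_tensor_map_iff:
  assumes M: "Module.module R M" and N: "Module.module R N" and P: "Module.module R P"
    and f: "f \<in> module_maps R M N"
  shows "inj_on (tensor_map R f N P) (carrier (tensor_product R M P)) \<longleftrightarrow>
    (\<forall>c. Poly_Mapping.keys c \<subseteq> carrier M \<times> carrier P \<longrightarrow>
      frag_extend (\<lambda>(x, y). frag_of (f x, y)) c \<in> tensor_relations R N P \<longrightarrow>
      c \<in> tensor_relations R M P)"
    (is "?L \<longleftrightarrow> ?R")
proof -
  let ?F = "frag_extend (\<lambda>(x, y). frag_of (f x, y))"
  let ?D = "carrier M \<times> carrier P"
  let ?cM = "\<lambda>a. tensor_relations R M P #>\<^bsub>free_Abelian_group ?D\<^esub> a"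
  have eqM: "?cM a = ?cM b \<longleftrightarrow> a - b \<in> tensor_relations R M P"
    if "Poly_Mapping.keys a \<subseteq> ?D" "Poly_Mapping.keys b \<subseteq> ?D" for a b
    by (rule r_coset_free_Abelian_group_eq_iff [OF tensor_relations_subgroup [OF M P] that])
  have eqN: "tensor_map R f N P (?cM a) = tensor_map R f N P (?cM b) \<longleftrightarrow>
      ?F (a - b) \<in> tensor_relations R N P"
    if "Poly_Mapping.keys a \<subseteq> ?D" "Poly_Mapping.keys b \<subseteq> ?D" for a b
    using that tensor_map_lift(1) [OF M N P f]
    by (simp add: tensor_map_coset [OF M N P f] frag_extend_diff
        r_coset_free_Abelian_group_eq_iff [OF tensor_relations_subgroup [OF N P]])
  have carr: "carrier (tensor_product R M P) = ?cM ` {a. Poly_Mapping.keys a \<subseteq> ?D}"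
    by (auto simp: tensor_product_def FactGroup_def RCOSETS_def)
  show ?thesis
  proof
    assume L: ?L
    show ?R
    proof (intro allI impI)
      fix c
      assume c: "Poly_Mapping.keys c \<subseteq> ?D" and "?F c \<in> tensor_relations R N P"
      then have "tensor_map R f N P (?cM c) = tensor_map R f N P (?cM 0)"
        by (simp add: eqN)
      then have "?cM c = ?cM 0"
        using L c by (elim inj_onD) (simp_all add: carr)
      then show "c \<in> tensor_relations R M P" using eqM [of c 0] c by simp
    qed
  next
    assume ?R
    then show ?L
      by (auto simp: carr inj_on_def eqM eqN keys_diff_subset)
  qed
qed

section \<open>Calculation modulo relations, and flatness from a dual basis\<close>

lemma tensor_relations_sum:
  assumes M: "Module.module R M" and P: "Module.module R P"
    and "\<And>w. w \<in> W \<Longrightarrow> a w \<in> tensor_relations R M P"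
  shows "sum a W \<in> tensor_relations R M P"
  using assms(3)
  by (induction W rule: infinite_finite_induct) (simp_all add: tensor_relations_closed [OF M P])

text \<open>The additivity relation for \<open>0 + 0 = 0\<close> is the negative of the formal sum
  in question.\<close>

lemma frag_of_zero_in_tensor_relations:
  assumes M: "Module.module R M" and P: "Module.module R P"
  shows "x \<in> carrier M \<Longrightarrow> frag_of (x, \<zero>\<^bsub>P\<^esub>) \<in> tensor_relations R M P"
    and "y \<in> carrier P \<Longrightarrow> frag_of (\<zero>\<^bsub>M\<^esub>, y) \<in> tensor_relations R M P"
proof -
  interpret M: Module.module R M by (rule M)
  interpret P: Module.module R P by (rule P)
  show "frag_of (x, \<zero>\<^bsub>P\<^esub>) \<in> tensor_relations R M P" if "x \<in> carrier M"
    using tensor_relations_closed(4) [OF M P tensor_relations_gens(2) [of x M "\<zero>\<^bsub>P\<^esub>" P "\<zero>\<^bsub>P\<^esub>" R]] that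
    by simp
  show "frag_of (\<zero>\<^bsub>M\<^esub>, y) \<in> tensor_relations R M P" if "y \<in> carrier P"
    using tensor_relations_closed(4) [OF M P tensor_relations_gens(1) [of "\<zero>\<^bsub>M\<^esub>" M "\<zero>\<^bsub>M\<^esub>" y P R]] that
    by simp
qed

lemma frag_of_minus_in_tensor_relations:
  assumes M: "Module.module R M" and P: "Module.module R P"
    and "x \<in> carrier M" "x' \<in> carrier M" "y \<in> carrier P"
  shows "frag_of (x \<ominus>\<^bsub>M\<^esub> x', y) - (frag_of (x, y) - frag_of (x', y)) \<in> tensor_relations R M P"
proof -
  interpret M: Module.module R M by (rule M)
  have "(x \<ominus>\<^bsub>M\<^esub> x') \<oplus>\<^bsub>M\<^esub> x' = x"
    using assms by (simp add: a_minus_def M.a_assoc M.l_neg)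
  then show ?thesis
    using tensor_relations_closed(4) [OF M P tensor_relations_gens(1) [of "x \<ominus>\<^bsub>M\<^esub> x'" M x' y P R]] assms
    by (simp add: algebra_simps)
qed

lemma frag_of_finsum_in_tensor_relations:
  assumes M: "Module.module R M" and P: "Module.module R P"
    and x: "x \<in> carrier M" and W: "finite W" and g: "g \<in> W \<rightarrow> carrier P"
  shows "frag_of (x, finsum P g W) - (\<Sum>w\<in>W. frag_of (x, g w)) \<in> tensor_relations R M P"
  using W g
proof (induction W rule: finite_induct)
  interpret P: Module.module R P by (rule P)
  case empty
  then show ?case
    using frag_of_zero_in_tensor_relations(1) [OF M P x] by simp
next
  interpret P: Module.module R P by (rule P)
  case (insert w W)
  have "frag_of (x, finsum P g (insert w W)) - frag_of (x, g w) - frag_of (x, finsum P g W)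
      \<in> tensor_relations R M P"
    using insert tensor_relations_gens(2) [of x M "g w" P "finsum P g W" R] x
    by (auto simp: Pi_iff)
  from tensor_relations_closed(3) [OF M P this insert.IH] insert
  show ?case by (simp add: Pi_iff algebra_simps)
qed

text \<open>The coordinates induce maps \<open>\<beta>\<^sub>w : M \<otimes> P \<rightarrow> M\<close>; every \<open>c\<close> is congruent to
  \<open>\<Sum>w. \<beta>\<^sub>w(c) \<otimes> b\<^sub>w\<close>, and the \<open>\<beta>\<^sub>w\<close> commute with linear maps.\<close>

lemma dual_basis_imp_flat_module:
  fixes R :: "('r, 'a) ring_scheme" and P :: "('r, 'p, 'b) module_scheme"
  assumes P: "Module.module R P" and W: "finite W"
    and b: "\<And>w. w \<in> W \<Longrightarrow> b w \<in> carrier P"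
    and coord_closed: "\<And>w p. w \<in> W \<Longrightarrow> p \<in> carrier P \<Longrightarrow> coord w p \<in> carrier R"
    and coord_add: "\<And>w p q. w \<in> W \<Longrightarrow> p \<in> carrier P \<Longrightarrow> q \<in> carrier P \<Longrightarrow>
      coord w (p \<oplus>\<^bsub>P\<^esub> q) = coord w p \<oplus>\<^bsub>R\<^esub> coord w q"
    and coord_smult: "\<And>w r p. w \<in> W \<Longrightarrow> r \<in> carrier R \<Longrightarrow> p \<in> carrier P \<Longrightarrow>
      coord w (r \<odot>\<^bsub>P\<^esub> p) = r \<otimes>\<^bsub>R\<^esub> coord w p"
    and expand: "\<And>p. p \<in> carrier P \<Longrightarrow> p = (\<Oplus>\<^bsub>P\<^esub>w\<in>W. coord w p \<odot>\<^bsub>P\<^esub> b w)"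
  shows "flat_module TYPE('m) R P"
proof -
  interpret P: Module.module R P by (rule P)
  \<comment> \<open>The properties of the map \<open>\<beta>\<^sub>w\<close>, taken on formal sums.
    The module is a parameter because the map is needed for \<open>M\<close> and for
    \<open>N\<close>.\<close>
  define is_coord where "is_coord M w h \<longleftrightarrow>
      (\<forall>x\<in>carrier M. \<forall>y\<in>carrier P. h (frag_of (x, y)) = coord w y \<odot>\<^bsub>M\<^esub> x) \<and>
      (\<forall>c\<in>tensor_relations R M P. h c = \<zero>\<^bsub>M\<^esub>) \<and>
      (\<forall>c. Poly_Mapping.keys c \<subseteq> carrier M \<times> carrier P \<longrightarrow> h c \<in> carrier M) \<and>
      (\<forall>c c'. Poly_Mapping.keys c \<subseteq> carrier M \<times> carrier P \<longrightarrow>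
        Poly_Mapping.keys c' \<subseteq> carrier M \<times> carrier P \<longrightarrow> h (c - c') = h c \<ominus>\<^bsub>M\<^esub> h c')"
    for M :: "('r, 'm) module" and w h
  have ex_coord: "\<exists>h. is_coord M w h"
    if M: "Module.module R M" and w: "w \<in> W" for w and M :: "('r, 'm) module"
  proof -
    interpret M: Module.module R M by (rule M)
    show ?thesis
    \<comment> \<open>That this map is balanced rests on the commutativity of
      \<open>R\<close>.\<close>
    proof (rule balanced_map_extends [OF M P M.a_comm_group, of "\<lambda>x y. coord w y \<odot>\<^bsub>M\<^esub> x"])
      fix h
      assume "h \<in> hom (free_Abelian_group (carrier M \<times> carrier P)) (add_monoid M)"
        and "\<And>x y. x \<in> carrier M \<Longrightarrow> y \<in> carrier P \<Longrightarrow> h (frag_of (x, y)) = coord w y \<odot>\<^bsub>M\<^esub> x"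
        and "\<And>c. c \<in> tensor_relations R M P \<Longrightarrow> h c = \<one>\<^bsub>add_monoid M\<^esub>"
        and "\<And>a b. Poly_Mapping.keys a \<subseteq> carrier M \<times> carrier P \<Longrightarrow>
          Poly_Mapping.keys b \<subseteq> carrier M \<times> carrier P \<Longrightarrow>
          h (a - b) = h a \<otimes>\<^bsub>add_monoid M\<^esub> inv\<^bsub>add_monoid M\<^esub> h b"
      then show ?thesis
        by (intro exI [of _ h]) (auto simp: is_coord_def a_minus_def a_inv_def hom_def Pi_iff)
    qed (use w in \<open>auto simp: coord_closed coord_add coord_smult M.smult_l_distr M.smult_r_distr
        M.smult_assoc1 [symmetric] P.R.m_comm\<close>)
  qed
  have "inj_on (tensor_map R f N P) (carrier (tensor_product R M P))"
    if M: "Module.module R M" and N: "Module.module R N"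
      and f: "f \<in> module_maps R M N" and inj: "inj_on f (carrier M)"
    for M N :: "('r, 'm) module" and f
    unfolding inj_on_tensor_map_iff [OF M N P f]
  proof (intro allI impI)
    interpret M: Module.module R M by (rule M)
    interpret N: Module.module R N by (rule N)
    let ?F = "frag_extend (\<lambda>(x, y). frag_of (f x, y))"
    let ?DM = "carrier M \<times> carrier P"
    let ?DN = "carrier N \<times> carrier P"
    have f_closed: "f x \<in> carrier N" if "x \<in> carrier M" for x
      using f that by (auto simp: module_maps_def)
    have f_add: "f (x \<oplus>\<^bsub>M\<^esub> y) = f x \<oplus>\<^bsub>N\<^esub> f y" if "x \<in> carrier M" "y \<in> carrier M" for x y
      using f that by (auto simp: module_maps_def)
    have f_smult: "f (r \<odot>\<^bsub>M\<^esub> x) = r \<odot>\<^bsub>N\<^esub> f x" if "r \<in> carrier R" "x \<in> carrier M" for r x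
      using f that by (auto simp: module_maps_def)
    have f_zero: "f \<zero>\<^bsub>M\<^esub> = \<zero>\<^bsub>N\<^esub>"
      using f_add [of "\<zero>\<^bsub>M\<^esub>" "\<zero>\<^bsub>M\<^esub>"] f_closed [of "\<zero>\<^bsub>M\<^esub>"] by simp
    have f_minus: "f (x \<ominus>\<^bsub>M\<^esub> y) = f x \<ominus>\<^bsub>N\<^esub> f y" if "x \<in> carrier M" "y \<in> carrier M" for x y
    proof -
      have "f (x \<ominus>\<^bsub>M\<^esub> y) \<oplus>\<^bsub>N\<^esub> f y = f x"
        using that by (simp add: f_add [symmetric] a_minus_def M.a_assoc M.l_neg)
      then have "f x \<ominus>\<^bsub>N\<^esub> f y = f (x \<ominus>\<^bsub>M\<^esub> y) \<oplus>\<^bsub>N\<^esub> f y \<ominus>\<^bsub>N\<^esub> f y" by simp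
      then show ?thesis
        using that by (simp add: f_closed a_minus_def N.a_assoc N.r_neg)
    qed
    obtain \<beta> where \<beta>: "\<And>w. w \<in> W \<Longrightarrow> is_coord M w (\<beta> w)"
      using bchoice [of W "is_coord M"] ex_coord [OF M] by auto
    obtain \<gamma> where \<gamma>: "\<And>w. w \<in> W \<Longrightarrow> is_coord N w (\<gamma> w)"
      using bchoice [of W "is_coord N"] ex_coord [OF N] by auto
    note \<beta>_of = \<beta> [unfolded is_coord_def, THEN conjunct1, rule_format]
    note \<beta>_rel = \<beta> [unfolded is_coord_def, THEN conjunct2, THEN conjunct1, rule_format]
    note \<beta>_closed = \<beta> [unfolded is_coord_def, THEN conjunct2, THEN conjunct2, THEN conjunct1, rule_format]
    note \<beta>_diff = \<beta> [unfolded is_coord_def, THEN conjunct2, THEN conjunct2, THEN conjunct2, rule_format]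
    note \<gamma>_of = \<gamma> [unfolded is_coord_def, THEN conjunct1, rule_format]
    note \<gamma>_rel = \<gamma> [unfolded is_coord_def, THEN conjunct2, THEN conjunct1, rule_format]
    note \<gamma>_diff = \<gamma> [unfolded is_coord_def, THEN conjunct2, THEN conjunct2, THEN conjunct2, rule_format]
    fix c
    assume c: "Poly_Mapping.keys c \<subseteq> ?DM" and Fc: "?F c \<in> tensor_relations R N P"
    \<comment> \<open>On a generator \<open>(x, y)\<close> this says that \<open>f\<close> commutes
      with the scalar \<open>coord w y\<close>; the induction extends it along differences.\<close>
    have natural: "f (\<beta> w c) = \<gamma> w (?F c)" if w: "w \<in> W" for w
      using c
    proof (induction c rule: free_Abelian_group_induct [consumes 1, case_names 1 2 3])
      case 1
      then show ?case
        using w M N P by (simp add: \<beta>_rel \<gamma>_rel tensor_relations_closed f_zero)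
    next
      case (2 x y)
      then show ?case
        using w tensor_map_lift(1) [OF M N P f]
        by (simp add: \<beta>_diff \<gamma>_diff f_minus \<beta>_closed frag_extend_diff)
    next
      case (3 a)
      then show ?case
        using w by (auto simp: \<beta>_of \<gamma>_of f_smult f_closed coord_closed)
    qed
    have expansion: "c - (\<Sum>w\<in>W. frag_of (\<beta> w c, b w)) \<in> tensor_relations R M P"
      using c
    proof (induction c rule: free_Abelian_group_induct [consumes 1, case_names 1 2 3])
      case 1
      \<comment> \<open>The sum belonging to \<open>0\<close> is not the zero formal sum: each term
        is a pair with first entry zero, which is merely a relation.\<close>
      have "(\<Sum>w\<in>W. frag_of (\<beta> w 0, b w)) \<in> tensor_relations R M P"
        by (rule tensor_relations_sum [OF M P])
           (simp add: \<beta>_rel tensor_relations_closed [OF M P]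
             frag_of_zero_in_tensor_relations(2) [OF M P] b)
      then show ?case by (simp add: tensor_relations_closed(4) [OF M P])
    next
      case (2 x y)
      have "(\<Sum>w\<in>W. frag_of (\<beta> w (x - y), b w) - (frag_of (\<beta> w x, b w) - frag_of (\<beta> w y, b w)))
          \<in> tensor_relations R M P"
        using 2 b
        by (intro tensor_relations_sum [OF M P])
           (simp add: \<beta>_diff \<beta>_closed frag_of_minus_in_tensor_relations [OF M P])
      from tensor_relations_closed(5) [OF M P tensor_relations_closed(5) [OF M P 2(3,4)] this [unfolded sum_subtractf]]
      show ?case by (simp add: algebra_simps)
    next
      case (3 a)
      then obtain x y where a: "a = (x, y)" "x \<in> carrier M" "y \<in> carrier P" by auto
      \<comment> \<open>First \<open>y\<close> is expanded in the \<open>b w\<close>, then the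
        scalars are moved to the left factor.\<close>
      have 1: "frag_of (x, y) - (\<Sum>w\<in>W. frag_of (x, coord w y \<odot>\<^bsub>P\<^esub> b w)) \<in> tensor_relations R M P"
        using frag_of_finsum_in_tensor_relations [OF M P a(2) W, of "\<lambda>w. coord w y \<odot>\<^bsub>P\<^esub> b w"]
        by (simp add: coord_closed a b Pi_iff flip: expand)
      have 2: "(\<Sum>w\<in>W. frag_of (coord w y \<odot>\<^bsub>M\<^esub> x, b w) - frag_of (x, coord w y \<odot>\<^bsub>P\<^esub> b w))
          \<in> tensor_relations R M P"
        by (intro tensor_relations_sum [OF M P] tensor_relations_gens)
           (simp_all add: a b coord_closed)
      from tensor_relations_closed(5) [OF M P 1 2]
      show ?case by (simp add: a \<beta>_of sum_subtractf)
    qed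
    \<comment> \<open>Here injectivity enters: \<open>f (\<beta> w c)\<close> equals
      \<open>\<gamma> w (?F c)\<close>, which is zero because \<open>?F c\<close> is a
      relation.\<close>
    have "\<beta> w c = \<zero>\<^bsub>M\<^esub>" if w: "w \<in> W" for w
      using inj_onD [OF inj, of "\<beta> w c" "\<zero>\<^bsub>M\<^esub>"] natural [OF w] w c Fc
      by (simp add: \<gamma>_rel f_zero \<beta>_closed)
    then have "(\<Sum>w\<in>W. frag_of (\<beta> w c, b w)) \<in> tensor_relations R M P"
      by (intro tensor_relations_sum [OF M P])
         (simp add: frag_of_zero_in_tensor_relations(2) [OF M P] b)
    from tensor_relations_closed(3) [OF M P expansion this]
    show "c \<in> tensor_relations R M P" by simp
  qed
  then show ?thesis
    using P by (auto simp: flat_module_def)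
qed

section \<open>Apery exponents\<close>

definition add_closed :: "nat set \<Rightarrow> bool"
  where "add_closed S \<longleftrightarrow> 0 \<in> S \<and> (\<forall>x\<in>S. \<forall>y\<in>S. x + y \<in> S)"

lemma add_closedD:
  assumes "add_closed S"
  shows add_closed_0: "0 \<in> S"
    and add_closed_add: "x \<in> S \<Longrightarrow> y \<in> S \<Longrightarrow> x + y \<in> S"
    and add_closed_mult: "x \<in> S \<Longrightarrow> k * x \<in> S"
  using assms by (induction k) (auto simp: add_closed_def)

lemma numerical_semigroup_of_nat_imp:
  assumes "numerical_semigroup (rat_of_nat ` S)"
  shows "add_closed S" and "\<exists>s\<in>S. 0 < s"
proof -
  let ?P = "\<lambda>T. 0 \<in> T \<and> (\<forall>x\<in>T. \<forall>y\<in>T. x + y \<in> T)"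
  obtain G where G: "G \<noteq> {}" "\<And>g. g \<in> G \<Longrightarrow> 0 < g" and S: "rat_of_nat ` S = ?P hull G"
    using assms by (auto simp: numerical_semigroup_def)
  \<comment> \<open>The defining property passes to intersections, so the hull has it.\<close>
  have "?P (?P hull G)"
    by (rule hull_in) auto
  then have P: "?P (rat_of_nat ` S)" unfolding S .
  have "x + y \<in> S" if "x \<in> S" "y \<in> S" for x y
  proof -
    have "rat_of_nat (x + y) \<in> rat_of_nat ` S" using P that by simp
    then show ?thesis by (metis imageE of_nat_eq_iff)
  qed
  moreover have "0 \<in> S" using P by auto
  ultimately show "add_closed S" by (simp add: add_closed_def)
  have "G \<subseteq> rat_of_nat ` S" unfolding S by (rule hull_subset)
  with G show "\<exists>s\<in>S. 0 < s" by fastforce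
qed

text \<open>Bezout's identity without negative numbers. The least positive difference
  \<open>g = a - b\<close> of elements of \<open>S\<close> divides every \<open>s\<close> in
  \<open>S\<close>: with \<open>q = s div g\<close>, the remainder is
  \<open>(s + q * b) - q * a\<close>, again such a difference.\<close>

lemma add_closed_Gcd_eq_diff:
  assumes S: "add_closed S"
  shows "\<exists>a\<in>S. \<exists>b\<in>S. a = b + Gcd S"
proof (cases "S \<subseteq> {0}")
  case True
  with add_closed_0 [OF S] have "S = {0}" by auto
  then show ?thesis by simp
next
  case False
  define D where "D n \<longleftrightarrow> 0 < n \<and> (\<exists>a\<in>S. \<exists>b\<in>S. a = b + n)" for n
  define g where "g = (LEAST n. D n)"
  obtain s where "s \<in> S" "0 < s" using False by auto
  with add_closed_0 [OF S] have "D s" by (force simp: D_def)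
  then have "D g" unfolding g_def by (rule LeastI)
  then obtain a b where ab: "0 < g" "a \<in> S" "b \<in> S" "a = b + g" by (auto simp: D_def)
  have "g dvd s" if s: "s \<in> S" for s
  proof (rule ccontr)
    assume "\<not> g dvd s"
    then have pos: "0 < s mod g" by (simp add: dvd_eq_mod_eq_0)
    have "s + (s div g) * b = (s div g) * a + s mod g"
      by (simp add: ab(4) distrib_left)
    with pos have "D (s mod g)"
      using add_closed_add [OF S s add_closed_mult [OF S ab(3)]] add_closed_mult [OF S ab(2)]
      unfolding D_def by blast
    then have "g \<le> s mod g" unfolding g_def by (rule Least_le)
    with mod_less_divisor [OF ab(1), of s] show False by simp
  qed
  then have "g dvd Gcd S" by (rule Gcd_greatest)
  moreover have "Gcd S dvd g"
    using Gcd_dvd [OF ab(2)] Gcd_dvd [OF ab(3)] ab(4) by (simp add: dvd_add_right_iff)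
  ultimately show ?thesis using ab by (auto dest: dvd_antisym)
qed

text \<open>The set \<open>W\<close> of the introduction; unlike the monomials it does not involve
  the field.\<close>

definition apery_exponents :: "nat set \<Rightarrow> nat set \<Rightarrow> nat set"
  where "apery_exponents S S' = {w \<in> S'. \<forall>s\<in>S. \<forall>t\<in>S'. w = s + t \<longrightarrow> s = 0}"

lemma inj_fps_X_power: "inj (\<lambda>n. fps_X ^ n :: 'k::field fps)"
proof (rule injI)
  fix m n
  assume "fps_X ^ m = (fps_X ^ n :: 'k fps)"
  then have "fps_nth (fps_X ^ m :: 'k fps) m = fps_nth (fps_X ^ n) m" by simp
  then show "m = n" by (simp add: fps_X_power_nth split: if_splits)
qed

lemma fps_X_power_eq_iff: "(fps_X ^ m :: 'k::field fps) = fps_X ^ n \<longleftrightarrow> m = n"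
  using inj_fps_X_power by (auto dest: injD)

lemma apery_monomials_eq:
  "(apery_monomials S S' :: 'k::field fps set) = (\<lambda>n. fps_X ^ n) ` apery_exponents S S'"
proof -
  have one: "(fps_X ^ s :: 'k fps) = 1 \<longleftrightarrow> s = 0" for s
    using fps_X_power_eq_iff [of s 0] by simp
  show ?thesis
    by (auto simp: apery_monomials_def monomials_def apery_exponents_def one fps_X_power_eq_iff
        simp flip: power_add)
qed

lemma fps_X_power_in_apery_monomials_iff:
  "(fps_X ^ n :: 'k::field fps) \<in> apery_monomials S S' \<longleftrightarrow> n \<in> apery_exponents S S'"
  by (auto simp: apery_monomials_eq fps_X_power_eq_iff)

lemma card_apery_monomials:
  "card (apery_monomials S S' :: 'k::field fps set) = card (apery_exponents S S')"
  unfolding apery_monomials_eq by (rule card_image) (rule inj_on_subset [OF inj_fps_X_power], simp)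

lemma apery_differences_eq:
  "apery_differences TYPE('k::field) S S' =
    {a - b | a b. b \<le> a \<and> a \<in> apery_exponents S S' \<and> b \<in> apery_exponents S S'}"
  by (simp add: apery_differences_def fps_X_power_in_apery_monomials_iff)

text \<open>By descent: an element of \<open>S'\<close> that is not an Apery exponent splits off a
  nonzero element of \<open>S\<close>, leaving a smaller element of \<open>S'\<close>.\<close>

lemma apery_decomposition:
  assumes S: "add_closed S" and t: "t \<in> S'"
  obtains s w where "s \<in> S" "w \<in> apery_exponents S S'" "t = s + w"
  using t
proof (induction t arbitrary: thesis rule: less_induct)
  case (less t)
  show ?case
  proof (cases "t \<in> apery_exponents S S'")
    case True
    then show ?thesis using less.prems(1) [of 0 t] add_closed_0 [OF S] by simp
  next
    case False
    then obtain s u where su: "s \<in> S" "u \<in> S'" "t = s + u" "s \<noteq> 0"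
      using less.prems(2) by (auto simp: apery_exponents_def)
    then obtain s' w where "s' \<in> S" "w \<in> apery_exponents S S'" "u = s' + w"
      using less.IH [of u] by auto
    then show ?thesis
      using less.prems(1) [of "s + s'" w] su add_closed_add [OF S] by simp
  qed
qed

text \<open>Otherwise \<open>w = (w - v) + v\<close> would split off the nonzero element
  \<open>w - v\<close> of \<open>S\<close>.\<close>

lemma apery_exponents_diff_notin:
  "v \<in> apery_exponents S S' \<Longrightarrow> w \<in> apery_exponents S S' \<Longrightarrow> v < w \<Longrightarrow> w - v \<notin> S"
  using le_add_diff_inverse2 [of v w] by (force simp: apery_exponents_def)

text \<open>Reduction modulo an element of \<open>S\<close>, in contrast to \<open>Gcd S\<close>, is
  always injective, since all multiples of \<open>m\<close> lie in \<open>S\<close>. This serves to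
  prove finiteness.\<close>

lemma inj_on_apery_exponents_mod:
  assumes S: "add_closed S" and m: "m \<in> S"
  shows "inj_on (\<lambda>w. w mod m) (apery_exponents S S')"
proof (rule linorder_inj_onI', rule notI)
  fix v w
  assume "v < w" "v \<in> apery_exponents S S'" "w \<in> apery_exponents S S'"
  moreover
  assume "v mod m = w mod m"
  then have "m dvd w - v" using \<open>v < w\<close> by (metis less_imp_le mod_eq_dvd_iff_nat)
  then have "w - v \<in> S" using add_closed_mult [OF S m] by (metis dvd_div_mult_self)
  ultimately show False
    using apery_exponents_diff_notin by blast
qed

text \<open>There is at most one exponent in each residue class modulo \<open>m\<close>. Finiteness
  matters because \<open>card\<close> of an infinite set is 0.\<close>

lemma finite_apery_exponents:
  assumes S: "add_closed S" and m: "m \<in> S" "0 < m"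
  shows "finite (apery_exponents S S')"
proof (rule finite_imageD)
  show "finite ((\<lambda>w. w mod m) ` apery_exponents S S')"
    by (rule finite_subset [of _ "{..<m}"]) (use m in auto)
qed (rule inj_on_apery_exponents_mod [OF S m(1)])

lemma apery_exponents_mod_Gcd:
  assumes S: "add_closed S" "0 < Gcd S" and S': "add_closed S'" and sub: "S \<subseteq> S'"
  shows "(\<lambda>w. w mod Gcd S) ` apery_exponents S S' =
    (\<lambda>j. j * Gcd S') ` {..<Gcd S div Gcd S'}"
proof -
  let ?d = "Gcd S" and ?d' = "Gcd S'"
  have dvd: "?d' dvd ?d"
    using sub by (auto intro!: Gcd_greatest)
  have "w mod ?d \<in> (\<lambda>j. j * ?d') ` {..<?d div ?d'}" if "w \<in> apery_exponents S S'" for w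
  proof -
    have "?d' dvd w" using that by (auto simp: apery_exponents_def)
    with dvd have "?d' dvd w mod ?d" by (simp add: dvd_mod)
    then obtain j where j: "w mod ?d = ?d' * j" ..
    have "?d' * j < ?d' * (?d div ?d')"
      using j dvd S(2) mod_less_divisor [of ?d w] by simp
    then show ?thesis by (auto simp: j mult.commute)
  qed
  moreover have "j * ?d' \<in> (\<lambda>w. w mod ?d) ` apery_exponents S S'" if "j < ?d div ?d'" for j
  proof -
    obtain a b where ab: "a \<in> S'" "b \<in> S'" "a = b + ?d'"
      using add_closed_Gcd_eq_diff [OF S'] by blast
    \<comment> \<open>The target is \<open>j * ?d' = j * a - j * b\<close>. To stay in
      \<open>S'\<close>, the summand \<open>- j * b\<close> is replaced by the congruent
      \<open>(?d - 1) * j * b\<close>; removing \<open>s\<close> in \<open>S\<close> then leaves the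
      residue modulo \<open>?d\<close> unchanged.\<close>
    have "j * a + (?d - 1) * j * b \<in> S'"
      using ab S' by (simp add: add_closedD)
    then obtain s w where sw: "s \<in> S" "w \<in> apery_exponents S S'" "j * a + (?d - 1) * j * b = s + w"
      by (rule apery_decomposition [OF S(1)])
    have "j * a + (?d - 1) * j * b = j * ?d' + ?d * (j * b)"
      using S(2) by (cases ?d) (simp_all add: ab(3) algebra_simps)
    moreover have "j * ?d' < ?d"
    proof -
      \<comment> \<open>Division by 0 yields 0, so \<open>j < ?d div ?d'\<close> excludes
        \<open>?d' = 0\<close>.\<close>
      have "0 < ?d'" using that by (intro gr0I) (simp del: Gcd_0_iff)
      with that have "j * ?d' < ?d div ?d' * ?d'" by (simp del: Gcd_0_iff)
      with dvd show ?thesis by simp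
    qed
    ultimately have "(s + w) mod ?d = j * ?d'" by (simp add: sw(3) [symmetric])
    moreover have "(s + w) mod ?d = w mod ?d"
      using sw(1) by (metis Gcd_dvd dvd_imp_mod_0 mod_add_left_eq add_0)
    ultimately show ?thesis using sw(2) by force
  qed
  ultimately show ?thesis by auto
qed

text \<open>The image of reduction has exactly \<open>Gcd S div Gcd S'\<close> elements, and a map
  on a finite set is injective iff its image has the same cardinality.\<close>

lemma card_apery_exponents:
  assumes S: "add_closed S" "0 < Gcd S" and S': "add_closed S'" and sub: "S \<subseteq> S'"
    and fin: "finite (apery_exponents S S')"
  shows "Gcd S div Gcd S' \<le> card (apery_exponents S S')"
    and "card (apery_exponents S S') = Gcd S div Gcd S' \<longleftrightarrow>
      inj_on (\<lambda>w. w mod Gcd S) (apery_exponents S S')"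
proof -
  have "\<not> S \<subseteq> {0}" using S(2) by (auto simp flip: Gcd_0_iff)
  with sub have "\<not> S' \<subseteq> {0}" by blast
  then have "Gcd S' \<noteq> 0" by simp
  then have card: "card ((\<lambda>w. w mod Gcd S) ` apery_exponents S S') = Gcd S div Gcd S'"
    unfolding apery_exponents_mod_Gcd [OF S S' sub] by (subst card_image) (auto simp: inj_on_def)
  show "Gcd S div Gcd S' \<le> card (apery_exponents S S')"
    using card_image_le [OF fin, of "\<lambda>w. w mod Gcd S"] unfolding card .
  show "card (apery_exponents S S') = Gcd S div Gcd S' \<longleftrightarrow>
      inj_on (\<lambda>w. w mod Gcd S) (apery_exponents S S')"
    unfolding inj_on_iff_eq_card [OF fin] card by (rule eq_commute)
qed

text \<open>A positive difference of Apery exponents is never in \<open>S\<close>. So both sides say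
  that congruent Apery exponents are equal; \<open>0 \<in> S\<close> accounts for the differences
  \<open>a - a\<close>.\<close>

lemma inj_on_apery_exponents_iff_differences:
  assumes S: "0 \<in> S"
  shows "inj_on (\<lambda>w. w mod Gcd S) (apery_exponents S S') \<longleftrightarrow>
    {a - b | a b. b \<le> a \<and> a \<in> apery_exponents S S' \<and> b \<in> apery_exponents S S'} \<inter>
      {n. Gcd S dvd n} \<subseteq> S"
    (is "?L \<longleftrightarrow> ?R")
proof
  assume L: ?L
  show ?R
  proof clarify
    fix a b
    assume ab: "b \<le> a" "a \<in> apery_exponents S S'" "b \<in> apery_exponents S S'" and "Gcd S dvd a - b"
    then have "a mod Gcd S = b mod Gcd S" by (simp add: mod_eq_dvd_iff_nat)
    with L ab have "a = b" by (auto dest: inj_onD)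
    then show "a - b \<in> S" using S by simp
  qed
next
  assume R: ?R
  show ?L
  proof (rule linorder_inj_onI', rule notI)
    fix v w
    assume vw: "v < w" "v \<in> apery_exponents S S'" "w \<in> apery_exponents S S'"
      and "v mod Gcd S = w mod Gcd S"
    then have "Gcd S dvd w - v" by (metis less_imp_le mod_eq_dvd_iff_nat)
    with vw have "w - v \<in> {a - b | a b. b \<le> a \<and> a \<in> apery_exponents S S' \<and> b \<in> apery_exponents S S'} \<inter>
        {n. Gcd S dvd n}"
      by (blast intro: less_imp_le)
    with R have "w - v \<in> S" by (rule subsetD)
    with vw show False
      using apery_exponents_diff_notin by blast
  qed
qed

text \<open>Elements of \<open>S\<close> vanish modulo \<open>Gcd S\<close>, so the sum determines
  the residue of \<open>w\<close>, hence \<open>w\<close>. This is the disjointness of the sets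
  \<open>w + S\<close>.\<close>

lemma apery_decomposition_unique:
  assumes inj: "inj_on (\<lambda>w. w mod Gcd S) (apery_exponents S S')"
    and "s \<in> S" "s' \<in> S" "w \<in> apery_exponents S S'" "w' \<in> apery_exponents S S'" "s + w = s' + w'"
  shows "w = w'" and "s = s'"
proof -
  have "(s + w) mod Gcd S = w mod Gcd S" "(s' + w') mod Gcd S = w' mod Gcd S"
    using assms(2,3) by (metis Gcd_dvd dvd_imp_mod_0 mod_add_left_eq add_0)+
  then show "w = w'" using assms by (auto dest: inj_onD)
  then show "s = s'" using assms by simp
qed

text \<open>If \<open>Gcd S\<close> divides \<open>t = s + w\<close>, then \<open>w\<close> is
  congruent to the Apery exponent 0, hence equal to it.\<close>

lemma inj_on_apery_exponents_imp_eq: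
  assumes S: "add_closed S" and S': "0 \<in> S'" and sub: "S \<subseteq> S'"
    and inj: "inj_on (\<lambda>w. w mod Gcd S) (apery_exponents S S')"
  shows "S = S' \<inter> {n. Gcd S dvd n}"
proof -
  have "t \<in> S" if t: "t \<in> S'" "Gcd S dvd t" for t
  proof -
    obtain s w where sw: "s \<in> S" "w \<in> apery_exponents S S'" "t = s + w"
      using apery_decomposition [OF S t(1)] .
    have "0 \<in> apery_exponents S S'" using S' by (auto simp: apery_exponents_def)
    moreover have "Gcd S dvd w" using t(2) sw by (simp add: dvd_add_right_iff)
    ultimately have "w = 0" using inj_onD [OF inj, of w 0] sw(2) by simp
    with sw show ?thesis by simp
  qed
  with sub show ?thesis by (auto intro: Gcd_dvd)
qed

section \<open>Semigroup algebras\<close>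

lemma fps_supported_on_closed:
  assumes S: "add_closed S"
  shows "(0 :: 'k::field fps) \<in> fps_supported_on S"
    and "(1 :: 'k fps) \<in> fps_supported_on S"
    and "(f :: 'k fps) \<in> fps_supported_on S \<Longrightarrow> g \<in> fps_supported_on S \<Longrightarrow> f + g \<in> fps_supported_on S"
    and "(f :: 'k fps) \<in> fps_supported_on S \<Longrightarrow> - f \<in> fps_supported_on S"
    and "(f :: 'k fps) \<in> fps_supported_on S \<Longrightarrow> g \<in> fps_supported_on S \<Longrightarrow> f * g \<in> fps_supported_on S"
    and "n \<in> S \<Longrightarrow> (fps_X ^ n :: 'k fps) \<in> fps_supported_on S"
proof -
  show "f + g \<in> fps_supported_on S"
    if "f \<in> fps_supported_on S" "g \<in> fps_supported_on S" for f g :: "'k fps"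
    unfolding fps_supported_on_def
  proof (intro CollectI allI impI)
    fix n
    assume "fps_nth (f + g) n \<noteq> 0"
    then have "fps_nth f n \<noteq> 0 \<or> fps_nth g n \<noteq> 0" by auto
    with that show "n \<in> S" by (auto simp: fps_supported_on_def)
  qed
  show "f * g \<in> fps_supported_on S"
    if f: "f \<in> fps_supported_on S" and g: "g \<in> fps_supported_on S" for f g :: "'k fps"
    unfolding fps_supported_on_def
  proof (intro CollectI allI impI)
    fix n
    assume "fps_nth (f * g) n \<noteq> 0"
    then obtain i where i: "i \<le> n" "fps_nth f i \<noteq> 0" "fps_nth g (n - i) \<noteq> 0"
      using sum.not_neutral_contains_not_neutral [of "\<lambda>i. fps_nth f i * fps_nth g (n - i)" "{0..n}"]
      by (auto simp: fps_mult_nth)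
    then have "i + (n - i) \<in> S"
      using f g by (intro add_closed_add [OF S]) (auto simp: fps_supported_on_def)
    with i(1) show "n \<in> S" by simp
  qed
qed (use add_closed_0 [OF S] in \<open>auto simp: fps_supported_on_def fps_X_power_nth split: if_splits\<close>)

lemma fps_supported_on_mono: "S \<subseteq> S' \<Longrightarrow> fps_supported_on S \<subseteq> fps_supported_on S'"
  by (auto simp: fps_supported_on_def)

lemma cring_semigroup_ring:
  assumes S: "add_closed S"
  shows "cring (semigroup_ring S :: 'k::field fps ring)"
proof (rule cringI)
  show "abelian_group (semigroup_ring S :: 'k fps ring)"
  proof (rule abelian_groupI)
    fix f :: "'k fps"
    assume "f \<in> carrier (semigroup_ring S)"
    then show "\<exists>g\<in>carrier (semigroup_ring S). g \<oplus>\<^bsub>semigroup_ring S\<^esub> f = \<zero>\<^bsub>semigroup_ring S\<^esub>"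
      by (intro bexI [of _ "- f"]) (auto simp: semigroup_ring_def fps_supported_on_closed [OF S])
  qed (auto simp: semigroup_ring_def fps_supported_on_closed [OF S])
  show "Group.comm_monoid (semigroup_ring S :: 'k fps ring)"
    by (rule comm_monoidI) (auto simp: semigroup_ring_def fps_supported_on_closed [OF S])
qed (auto simp: semigroup_ring_def distrib_right)

text \<open>Flatness is tested on modules over an abstract type \<open>'m\<close>, so sets of power series are
  copied there along an injection \<open>h\<close>. The multiplication of the record plays no role for
  modules.\<close>

definition copy_module :: "('k::field fps \<Rightarrow> 'm) \<Rightarrow> 'k fps set \<Rightarrow> ('k fps, 'm) module"
  where "copy_module h I =
    \<lparr>carrier = h ` I, monoid.mult = (\<lambda>x y. h (inv_into UNIV h x * inv_into UNIV h y)), one = h 1, ring.zero = h 0,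
     add = (\<lambda>x y. h (inv_into UNIV h x + inv_into UNIV h y)), smult = (\<lambda>r x. h (r * inv_into UNIV h x))\<rparr>"

lemma copy_module_simps:
  assumes "inj h"
  shows "carrier (copy_module h I) = h ` I"
    and "\<zero>\<^bsub>copy_module h I\<^esub> = h 0"
    and "h f \<oplus>\<^bsub>copy_module h I\<^esub> h g = h (f + g)"
    and "r \<odot>\<^bsub>copy_module h I\<^esub> h f = h (r * f)"
  using assms by (simp_all add: copy_module_def)

text \<open>Covers copied modules as well as \<open>semigroup_algebra\<close>, the latter with
  \<open>h = id\<close>: the module laws are inherited from power series along
  \<open>h\<close>.\<close>

lemma module_of_fps:
  fixes M :: "('k::field fps, 'm) module"
  assumes S: "add_closed S"
    and simps: "carrier M = h ` I" "\<zero>\<^bsub>M\<^esub> = h 0" "\<And>f g. h f \<oplus>\<^bsub>M\<^esub> h g = h (f + g)"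
      "\<And>r f. r \<odot>\<^bsub>M\<^esub> h f = h (r * f)"
    and "0 \<in> I" and "\<And>f g. f \<in> I \<Longrightarrow> g \<in> I \<Longrightarrow> f + g \<in> I" and "\<And>f. f \<in> I \<Longrightarrow> - f \<in> I"
    and "\<And>r f. r \<in> fps_supported_on S \<Longrightarrow> f \<in> I \<Longrightarrow> r * f \<in> I"
  shows "Module.module (semigroup_ring S) M"
proof (rule moduleI [OF cring_semigroup_ring [OF S]])
  show "abelian_group M"
  proof (rule abelian_groupI)
    fix x
    assume "x \<in> carrier M"
    then obtain f where "f \<in> I" "x = h f" by (auto simp: simps)
    then show "\<exists>y\<in>carrier M. y \<oplus>\<^bsub>M\<^esub> x = \<zero>\<^bsub>M\<^esub>"
      using assms(8) by (intro bexI [of _ "h (- f)"]) (auto simp: simps)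
  qed (auto simp: simps add_ac assms(6-))
qed (auto simp: simps semigroup_ring_def algebra_simps assms(6-))

lemma module_copy_module:
  fixes h :: "'k::field fps \<Rightarrow> 'm"
  assumes "add_closed S" and inj: "inj h"
    and "0 \<in> I" and "\<And>f g. f \<in> I \<Longrightarrow> g \<in> I \<Longrightarrow> f + g \<in> I" and "\<And>f. f \<in> I \<Longrightarrow> - f \<in> I"
    and "\<And>r f. r \<in> fps_supported_on S \<Longrightarrow> f \<in> I \<Longrightarrow> r * f \<in> I"
  shows "Module.module (semigroup_ring S) (copy_module h I)"
  by (rule module_of_fps [where h = h and I = I]) (use assms in \<open>simp_all add: copy_module_simps\<close>)

lemma module_semigroup_algebra:
  assumes S: "add_closed S" and S': "add_closed S'" and sub: "S \<subseteq> S'"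
  shows "Module.module (semigroup_ring S :: 'k::field fps ring) (semigroup_algebra S')"
  by (rule module_of_fps [where h = id and I = "fps_supported_on S'"])
     (use S fps_supported_on_mono [OF sub] in
       \<open>auto simp: semigroup_algebra_def fps_supported_on_closed [OF S']\<close>)

lemma finsum_semigroup_algebra:
  assumes S: "add_closed S" and S': "add_closed S'" and sub: "S \<subseteq> S'"
    and W: "finite W" and g: "\<And>w. w \<in> W \<Longrightarrow> (g w :: 'k::field fps) \<in> fps_supported_on S'"
  shows "finsum (semigroup_algebra S') g W = sum g W"
proof -
  interpret Module.module "semigroup_ring S :: 'k fps ring" "semigroup_algebra S'"
    by (rule module_semigroup_algebra [OF S S' sub])
  show ?thesis
    using W g
  proof (induction W rule: finite_induct)
    case empty
    have "\<zero>\<^bsub>semigroup_algebra S'\<^esub> = (0 :: 'k fps)" by (simp add: semigroup_algebra_def)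
    then show ?case by (simp only: finsum_empty sum.empty)
  next
    case (insert w W)
    then have "finsum (semigroup_algebra S') g (insert w W) =
        g w \<oplus>\<^bsub>semigroup_algebra S'\<^esub> finsum (semigroup_algebra S') g W"
      by (intro finsum_insert) (auto simp: semigroup_algebra_def)
    with insert show ?case by (simp add: semigroup_algebra_def)
  qed
qed

text \<open>The part of \<open>g\<close> supported on \<open>w + S\<close>, divided by
  \<open>u\<^sup>w\<close>: the coordinate of \<open>g\<close> at the basis element
  \<open>u\<^sup>w\<close> when the sets \<open>w + S\<close> partition \<open>S'\<close>.\<close>

definition apery_coord :: "nat set \<Rightarrow> nat \<Rightarrow> 'k::field fps \<Rightarrow> 'k fps"
  where "apery_coord S w g = Abs_fps (\<lambda>n. if n \<in> S then fps_nth g (n + w) else 0)"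

text \<open>Multiplication by a monomial of \<open>R\<close> maps each \<open>w + S\<close> into
  itself. As these sets are disjoint, only the part of \<open>g\<close> on \<open>w + S\<close>
  contributes to that of \<open>r * g\<close>.\<close>

lemma apery_coord_mult:
  fixes r g :: "'k::field fps"
  assumes S: "add_closed S" and inj: "inj_on (\<lambda>w. w mod Gcd S) (apery_exponents S S')"
    and w: "w \<in> apery_exponents S S'"
    and r: "r \<in> fps_supported_on S" and g: "g \<in> fps_supported_on S'"
  shows "apery_coord S w (r * g) = r * apery_coord S w g"
proof (rule fps_ext)
  fix n
  let ?R = "\<lambda>i. fps_nth r i * (if n - i \<in> S then fps_nth g (n - i + w) else 0)"
  have R: "fps_nth (r * apery_coord S w g) n = sum ?R {0..n}"
    by (simp add: apery_coord_def fps_mult_nth)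
  have rS: "i \<in> S" if "fps_nth r i \<noteq> 0" for i
    using r that by (auto simp: fps_supported_on_def)
  have gS: "j \<in> S'" if "fps_nth g j \<noteq> 0" for j
    using g that by (auto simp: fps_supported_on_def)
  \<comment> \<open>Writing \<open>n + w - i = t + v\<close> gives two decompositions of
    \<open>n + w\<close>, so \<open>n = i + t\<close>. Thus terms with \<open>i > n\<close> vanish,
    and the others have \<open>n - i\<close> in \<open>S\<close>.\<close>
  have key: "\<exists>t\<in>S. n = i + t"
    if n: "n \<in> S" and i: "i \<in> S" "i \<le> n + w" and g: "fps_nth g (n + w - i) \<noteq> 0" for i
  proof -
    obtain t v where tv: "t \<in> S" "v \<in> apery_exponents S S'" "n + w - i = t + v"
      using apery_decomposition [OF S gS [OF g]] .
    then have "n + w = (i + t) + v" using i by simp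
    from apery_decomposition_unique(2) [OF inj n add_closed_add [OF S i(1) tv(1)] w tv(2) this] tv(1)
    show ?thesis by blast
  qed
  show "fps_nth (apery_coord S w (r * g)) n = fps_nth (r * apery_coord S w g) n"
  proof (cases "n \<in> S")
    case False
    have "?R i = 0" if "i \<in> {0..n}" for i
      using add_closed_add [OF S, of i "n - i"] rS [of i] False that by auto
    then have "sum ?R {0..n} = 0" by (rule sum.neutral [OF ballI])
    moreover have "fps_nth (apery_coord S w (r * g)) n = 0"
      using False by (simp add: apery_coord_def)
    ultimately show ?thesis by (simp only: R)
  next
    case True
    have "(\<Sum>i=0..n + w. fps_nth r i * fps_nth g (n + w - i)) = sum ?R {0..n}"
    proof (rule sum.mono_neutral_cong_right)
      show "\<forall>i\<in>{0..n + w} - {0..n}. fps_nth r i * fps_nth g (n + w - i) = 0"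
        using key [OF True] rS by fastforce
      show "fps_nth r i * fps_nth g (n + w - i) = ?R i" if "i \<in> {0..n}" for i
        using that key [OF True, of i] rS [of i]
        by (cases "fps_nth r i = 0"; cases "fps_nth g (n + w - i) = 0") auto
    qed auto
    with True show ?thesis by (simp add: R apery_coord_def fps_mult_nth)
  qed
qed

text \<open>For each \<open>m\<close> in \<open>S'\<close> exactly one summand contributes to the
  coefficient at \<open>m\<close>, namely that of the unique \<open>w\<close> with \<open>m\<close>
  in \<open>w + S\<close>.\<close>

lemma apery_expansion:
  fixes g :: "'k::field fps"
  assumes S: "add_closed S" and S': "add_closed S'" and sub: "S \<subseteq> S'"
    and inj: "inj_on (\<lambda>w. w mod Gcd S) (apery_exponents S S')"
    and fin: "finite (apery_exponents S S')" and g: "g \<in> fps_supported_on S'"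
  shows "g = (\<Sum>w\<in>apery_exponents S S'. apery_coord S w g * fps_X ^ w)"
proof (rule fps_ext)
  fix m
  let ?c = "\<lambda>w. if w \<le> m \<and> m - w \<in> S then fps_nth g m else 0"
  have "fps_nth (\<Sum>w\<in>apery_exponents S S'. apery_coord S w g * fps_X ^ w) m =
      sum ?c (apery_exponents S S')"
    by (simp add: fps_sum_nth fps_X_power_mult_right_nth apery_coord_def) (rule sum.cong, auto)
  also have "\<dots> = fps_nth g m"
  proof (cases "m \<in> S'")
    case False
    then have "fps_nth g m = 0" using g by (auto simp: fps_supported_on_def)
    then show ?thesis by (subst sum.neutral) auto
  next
    case True
    then obtain s v where sv: "s \<in> S" "v \<in> apery_exponents S S'" "m = s + v"
      by (rule apery_decomposition [OF S])
    have "w = v" if "w \<in> apery_exponents S S'" "w \<le> m" "m - w \<in> S" for w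
      using apery_decomposition_unique(1) [OF inj that(3) sv(1) that(1) sv(2)] that(2) sv(3) by simp
    then have "sum ?c (apery_exponents S S') = sum ?c {v}"
      using sv by (intro sum.mono_neutral_right fin) auto
    then show ?thesis using sv by simp
  qed
  finally show "fps_nth g m = fps_nth (\<Sum>w\<in>apery_exponents S S'. apery_coord S w g * fps_X ^ w) m"
    by simp
qed

text \<open>\<open>R'\<close> is free over \<open>R\<close> on the Apery monomials, with coordinates
  \<open>apery_coord S w\<close>.\<close>

lemma flat_semigroup_algebra:
  assumes S: "add_closed S" and S': "add_closed S'" and sub: "S \<subseteq> S'"
    and inj: "inj_on (\<lambda>w. w mod Gcd S) (apery_exponents S S')"
    and fin: "finite (apery_exponents S S')"
  shows "flat_module TYPE('m) (semigroup_ring S :: 'k::field fps ring) (semigroup_algebra S')"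
proof (rule dual_basis_imp_flat_module [where W = "apery_exponents S S'" and b = "\<lambda>w. fps_X ^ w"
      and coord = "apery_coord S"])
  show "Module.module (semigroup_ring S :: 'k fps ring) (semigroup_algebra S')"
    by (rule module_semigroup_algebra [OF S S' sub])
  show coord: "apery_coord S w g \<in> carrier (semigroup_ring S)" for w and g :: "'k fps"
    by (auto simp: semigroup_ring_def fps_supported_on_def apery_coord_def)
  show "fps_X ^ w \<in> carrier (semigroup_algebra S' :: ('k fps, 'k fps) module)"
    if "w \<in> apery_exponents S S'" for w
    using that by (simp add: semigroup_algebra_def fps_supported_on_closed [OF S'] apery_exponents_def)
  show "apery_coord S w (f \<oplus>\<^bsub>semigroup_algebra S'\<^esub> g) =
      apery_coord S w f \<oplus>\<^bsub>semigroup_ring S\<^esub> apery_coord S w g" for w and f g :: "'k fps"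
    by (auto simp: semigroup_algebra_def semigroup_ring_def apery_coord_def fps_eq_iff)
  show "apery_coord S w (r \<odot>\<^bsub>semigroup_algebra S'\<^esub> g) = r \<otimes>\<^bsub>semigroup_ring S\<^esub> apery_coord S w g"
    if "w \<in> apery_exponents S S'" "r \<in> carrier (semigroup_ring S)" "g \<in> carrier (semigroup_algebra S')"
    for w and r g :: "'k fps"
    using apery_coord_mult [OF S inj that(1), of r g] that
    by (simp add: semigroup_algebra_def semigroup_ring_def)
  show "g = (\<Oplus>\<^bsub>semigroup_algebra S'\<^esub>w\<in>apery_exponents S S'.
      apery_coord S w g \<odot>\<^bsub>semigroup_algebra S'\<^esub> fps_X ^ w)"
    if "g \<in> carrier (semigroup_algebra S')" for g :: "'k fps"
  proof -
    have "apery_coord S w g * fps_X ^ w \<in> fps_supported_on S'" if "w \<in> apery_exponents S S'" for w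
      using that coord [of w g] fps_supported_on_mono [OF sub]
      by (intro fps_supported_on_closed [OF S']) (auto simp: semigroup_ring_def apery_exponents_def)
    moreover have "g = (\<Sum>w\<in>apery_exponents S S'. apery_coord S w g * fps_X ^ w)"
      using that by (intro apery_expansion [OF S S' sub inj fin]) (simp add: semigroup_algebra_def)
    ultimately show ?thesis
      using finsum_semigroup_algebra [OF S S' sub fin, of "\<lambda>w. apery_coord S w g * fps_X ^ w"]
      by (simp add: semigroup_algebra_def)
  qed
qed (rule fin)

text \<open>The element \<open>u\<^sup>s \<otimes> u\<^sup>w - u\<^sup>t \<otimes> u\<^sup>v\<close> of \<open>I \<otimes> R'\<close> vanishes in \<open>R \<otimes> R'\<close>. It is nonzero
  because \<open>(f, g) \<mapsto> f\<^sub>s g\<^sub>w\<close> is balanced on \<open>I \<times> R'\<close>: the coefficients \<open>f\<^sub>s\<close> and \<open>g\<^sub>w\<close> see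
  only the constant term of a scalar.\<close>

lemma flat_semigroup_algebra_imp_inj_on:
  assumes S: "add_closed S" and S': "add_closed S'" and sub: "S \<subseteq> S'"
    and emb: "\<exists>h :: 'k::field fps \<Rightarrow> 'm. inj h"
    and flat: "flat_module TYPE('m) (semigroup_ring S :: 'k fps ring) (semigroup_algebra S')"
  shows "inj_on (\<lambda>w. w mod Gcd S) (apery_exponents S S')"
proof (rule linorder_inj_onI', rule notI)
  fix v w
  assume vw: "v \<in> apery_exponents S S'" "w \<in> apery_exponents S S'" "v < w"
    and "v mod Gcd S = w mod Gcd S"
  then have "Gcd S dvd w - v" by (metis less_imp_le mod_eq_dvd_iff_nat)
  then obtain k where k: "w - v = Gcd S * k" ..
  obtain a b where ab: "a \<in> S" "b \<in> S" "a = b + Gcd S"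
    using add_closed_Gcd_eq_diff [OF S] by blast
  then have "k * a = k * b + (w - v)"
    using k by (simp add: distrib_left mult.commute)
  with vw(3) have "k * b + w = k * a + v" "k * b < k * a" by simp_all
  \<comment> \<open>The witnesses are \<open>s = k * b\<close> and \<open>t = k * a\<close>.\<close>
  then obtain s t where st: "s \<in> S" "t \<in> S" "s + w = t + v" "s < t"
    using add_closed_mult [OF S ab(1)] add_closed_mult [OF S ab(2)] by blast
  obtain h :: "'k fps \<Rightarrow> 'm" where h: "inj h" using emb by blast
  define R where "R = (semigroup_ring S :: 'k fps ring)"
  define P where "P = (semigroup_algebra S' :: ('k fps, 'k fps) module)"
  define I where "I = {f \<in> fps_supported_on S :: 'k fps set. \<forall>n<s. fps_nth f n = 0}"
  define M where "M = copy_module h I"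
  define N where "N = copy_module h (fps_supported_on S)"
  define X where "X n = (fps_X ^ n :: 'k fps)" for n
  have carrier_R: "carrier R = fps_supported_on S" by (simp add: R_def semigroup_ring_def)
  have carrier_P: "carrier P = fps_supported_on S'" by (simp add: P_def semigroup_algebra_def)
  have P_simps: "f \<oplus>\<^bsub>P\<^esub> g = f + g" "r \<odot>\<^bsub>P\<^esub> f = r * f" for r f g
    by (simp_all add: P_def semigroup_algebra_def)
  note M_simps = copy_module_simps [OF h, of I, folded M_def]
  note N_simps = copy_module_simps [OF h, of "fps_supported_on S", folded N_def]
  \<comment> \<open>A series in \<open>I\<close> has no terms below \<open>s\<close>, so only the
    constant term of \<open>r\<close> contributes.\<close>
  have mult_s: "fps_nth (r * f) s = fps_nth r 0 * fps_nth f s" if "f \<in> I" for r f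
  proof -
    have "fps_nth (r * f) s = (\<Sum>i=0..s. fps_nth r i * fps_nth f (s - i))"
      by (rule fps_mult_nth)
    also have "\<dots> = (\<Sum>i\<in>{0}. fps_nth r i * fps_nth f (s - i))"
      using that by (intro sum.mono_neutral_right) (auto simp: I_def)
    finally show ?thesis by simp
  qed
  \<comment> \<open>A further term would split \<open>w\<close> as \<open>i + (w - i)\<close> with
    nonzero \<open>i\<close> in \<open>S\<close>, but \<open>w\<close> is an Apery exponent.\<close>
  have mult_w: "fps_nth (r * g) w = fps_nth r 0 * fps_nth g w"
    if "r \<in> fps_supported_on S" "g \<in> fps_supported_on S'" for r g :: "'k fps"
  proof -
    have "fps_nth r i * fps_nth g (w - i) = 0" if "0 < i" "i \<le> w" for i
      using vw(2) that \<open>r \<in> _\<close> \<open>g \<in> _\<close>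
      by (auto simp: apery_exponents_def fps_supported_on_def) (metis le_add_diff_inverse not_less_zero)
    then have "(\<Sum>i=0..w. fps_nth r i * fps_nth g (w - i)) =
        (\<Sum>i\<in>{0}. fps_nth r i * fps_nth g (w - i))"
      by (intro sum.mono_neutral_right) auto
    then show ?thesis by (simp add: fps_mult_nth)
  qed
  have mult_low: "fps_nth (r * f) n = 0" if "f \<in> I" "n < s" for r f n
    using that by (auto simp: I_def fps_mult_nth intro!: sum.neutral)
  have module_M: "Module.module R M"
    unfolding R_def M_def
    by (rule module_copy_module [OF S h])
       (use mult_low in \<open>auto simp: I_def fps_supported_on_closed [OF S]\<close>)
  have module_N: "Module.module R N"
    unfolding R_def N_def
    by (rule module_copy_module [OF S h]) (auto simp: fps_supported_on_closed [OF S])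
  have module_P: "Module.module R P"
    unfolding R_def P_def by (rule module_semigroup_algebra [OF S S' sub])
  \<comment> \<open>Both modules are copied along the same \<open>h\<close>, so the inclusion of
    \<open>I\<close> becomes the identity.\<close>
  have map: "id \<in> module_maps R M N"
    by (auto simp: module_maps_def M_simps N_simps) (auto simp: I_def)
  have X_I: "X s \<in> I" "X t \<in> I"
    using st by (auto simp: X_def I_def fps_supported_on_closed [OF S] fps_X_power_nth)
  have X_R: "X s \<in> carrier R" "X t \<in> carrier R" "1 \<in> carrier R"
    using st by (auto simp: X_def carrier_R fps_supported_on_closed [OF S])
  have X_P: "X v \<in> carrier P" "X w \<in> carrier P"
    using vw by (auto simp: X_def carrier_P fps_supported_on_closed [OF S'] apery_exponents_def)
  define c where "c = frag_of (h (X s), X w) - frag_of (h (X t), X v)"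
  have c_keys: "Poly_Mapping.keys c \<subseteq> carrier M \<times> carrier P"
    unfolding c_def using X_I X_P by (intro keys_diff_subset) (auto simp: M_simps)
  have XX: "X s * X w = X t * X v"
    by (simp add: X_def st(3) flip: power_add)
  \<comment> \<open>In \<open>N\<close> both monomial scalars can be pulled off \<open>h 1\<close>,
    so both terms of \<open>c\<close> become \<open>h 1\<close> paired with the same
    product.\<close>
  have "frag_of (r \<odot>\<^bsub>N\<^esub> h 1, g) - frag_of (h 1, r \<odot>\<^bsub>P\<^esub> g) \<in> tensor_relations R N P"
    if "r \<in> carrier R" "g \<in> carrier P" for r g
    using that X_R(3) by (intro tensor_relations_gens) (auto simp: N_simps carrier_R)
  from tensor_relations_closed(5) [OF module_N module_P this [OF X_R(1) X_P(2)] this [OF X_R(2) X_P(1)]]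
  have "c \<in> tensor_relations R N P"
    by (simp add: N_simps P_simps XX c_def)
  then have "frag_extend (\<lambda>(x, y). frag_of (id x, y)) c \<in> tensor_relations R N P"
    by (simp add: c_def frag_extend_diff)
  moreover have "inj_on (tensor_map R id N P) (carrier (tensor_product R M P))"
    using flat module_M module_N map unfolding flat_module_def R_def [symmetric] P_def [symmetric]
    by auto
  ultimately have c: "c \<in> tensor_relations R M P"
    using c_keys unfolding inj_on_tensor_map_iff [OF module_M module_N module_P map] by blast
  \<comment> \<open>The additive group of the field, in the multiplicative notation that
    \<open>balanced_map_extends\<close> expects.\<close>
  define A :: "'k monoid" where "A = \<lparr>carrier = UNIV, monoid.mult = (+), one = 0\<rparr>"
  have A: "comm_group A"
  proof (rule comm_groupI)
    fix x
    show "\<exists>y\<in>carrier A. y \<otimes>\<^bsub>A\<^esub> x = \<one>\<^bsub>A\<^esub>"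
      by (rule bexI [of _ "- x"]) (auto simp: A_def)
  qed (auto simp: A_def)
  then interpret A: comm_group A .
  obtain \<Phi> where \<Phi>_of: "\<And>x y. x \<in> carrier M \<Longrightarrow> y \<in> carrier P \<Longrightarrow>
        \<Phi> (frag_of (x, y)) = fps_nth (inv_into UNIV h x) s * fps_nth y w"
    and \<Phi>_rel: "\<And>c. c \<in> tensor_relations R M P \<Longrightarrow> \<Phi> c = \<one>\<^bsub>A\<^esub>"
    and \<Phi>_diff: "\<And>a b. Poly_Mapping.keys a \<subseteq> carrier M \<times> carrier P \<Longrightarrow>
      Poly_Mapping.keys b \<subseteq> carrier M \<times> carrier P \<Longrightarrow> \<Phi> (a - b) = \<Phi> a \<otimes>\<^bsub>A\<^esub> inv\<^bsub>A\<^esub> (\<Phi> b)"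
  proof (rule balanced_map_extends [OF module_M module_P A, of "\<lambda>x y. fps_nth (inv_into UNIV h x) s * fps_nth y w"])
    show "fps_nth (inv_into UNIV h (r \<odot>\<^bsub>M\<^esub> x)) s * fps_nth y w = fps_nth (inv_into UNIV h x) s * fps_nth (r \<odot>\<^bsub>P\<^esub> y) w"
      if "r \<in> carrier R" "x \<in> carrier M" "y \<in> carrier P" for r x y
      using that h by (auto simp: M_simps P_simps mult_s mult_w carrier_R carrier_P)
  qed (use h in \<open>auto simp: A_def M_simps P_simps algebra_simps\<close>)
  \<comment> \<open>The first value is the 1 of the field; the second is the neutral element of
    \<open>A\<close>, that is 0, because \<open>s < t\<close>.\<close>
  have "\<Phi> (frag_of (h (X s), X w)) = 1" "\<Phi> (frag_of (h (X t), X v)) = \<one>\<^bsub>A\<^esub>"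
    using X_I X_P st vw h by (auto simp: \<Phi>_of M_simps X_def fps_X_power_nth A_def)
  then have "\<Phi> c = 1"
    using X_I X_P A.inv_one unfolding c_def by (subst \<Phi>_diff) (auto simp: M_simps A_def)
  with \<Phi>_rel [OF c] show False by (simp add: A_def)
qed

text \<open>Differences are tested against multiples of \<open>d\<close>, which are those of
  \<open>d div d'\<close> when \<open>d' = 1\<close>. For general \<open>d'\<close> the latter would
  fail: \<open>S = 4 * \<nat>\<close> and \<open>S' = 2 * \<nat>\<close> give a free algebra with
  Apery exponents 0 and 2, whose difference 2 is a multiple of \<open>d div d' = 2\<close> outside
  \<open>S\<close>.\<close>

theorem proposition3p5:
  fixes S S' :: "nat set" and d d' :: nat
  assumes "numerical_semigroup (rat_of_nat ` S)"
    and "numerical_semigroup (rat_of_nat ` S')"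
    and "S \<subseteq> S'"
    and "d = Gcd S" and "d' = Gcd S'"
    and "\<exists>h :: 'k::field fps \<Rightarrow> 'm. inj h"
  shows "d div d' \<le> card (apery_monomials S S' :: 'k fps set) \<and>
    (flat_module TYPE('m) (semigroup_ring S :: 'k fps ring) (semigroup_algebra S') \<longleftrightarrow>
      card (apery_monomials S S' :: 'k fps set) = d div d') \<and>
    (card (apery_monomials S S' :: 'k fps set) = d div d' \<longleftrightarrow>
      apery_differences TYPE('k) S S' \<inter> {n. d dvd n} \<subseteq> S) \<and>
    (flat_module TYPE('m) (semigroup_ring S :: 'k fps ring) (semigroup_algebra S') \<longrightarrow>
      S = S' \<inter> {n. d dvd n})"
proof -
  note S = numerical_semigroup_of_nat_imp(1) [OF assms(1)]
  note S' = numerical_semigroup_of_nat_imp(1) [OF assms(2)]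
  obtain s where s: "s \<in> S" "0 < s"
    using numerical_semigroup_of_nat_imp(2) [OF assms(1)] by blast
  then have "\<not> S \<subseteq> {0}" by auto
  then have pos: "0 < Gcd S" by (simp flip: neq0_conv)
  have fin: "finite (apery_exponents S S')"
    by (rule finite_apery_exponents [OF S s])
  \<comment> \<open>Each of the three conditions is shown equivalent to this one.\<close>
  let ?inj = "inj_on (\<lambda>w. w mod Gcd S) (apery_exponents S S')"
  have "flat_module TYPE('m) (semigroup_ring S :: 'k fps ring) (semigroup_algebra S') \<longleftrightarrow> ?inj"
    using flat_semigroup_algebra [OF S S' assms(3) _ fin]
      flat_semigroup_algebra_imp_inj_on [OF S S' assms(3,6)] by blast
  moreover have "?inj \<longleftrightarrow> apery_differences TYPE('k) S S' \<inter> {n. d dvd n} \<subseteq> S"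
    unfolding apery_differences_eq assms(4)
    by (rule inj_on_apery_exponents_iff_differences [OF add_closed_0 [OF S]])
  moreover have "?inj \<longrightarrow> S = S' \<inter> {n. d dvd n}"
    unfolding assms(4)
    using inj_on_apery_exponents_imp_eq [OF S add_closed_0 [OF S'] assms(3)] by blast
  moreover note card_apery_exponents [OF S pos S' assms(3) fin, folded assms(4,5)]
  ultimately show ?thesis
    unfolding card_apery_monomials assms(4) by blast
qed

end
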